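(* Let $D$ be a fourling shape (possibly empty) and let $n\geq 0$ be an even integer. Then $$\sum_{\lambda}(-1)^{v(\lambda)}I_\lambda^2=0,$$ where the sum is taken over all shapes $\lambda\vdash n$ with fourling body $\mathrm{fb}(\lambda)=D$.
   Context: A shape $\lambda$ is the Ferrers diagram of an integer partition; $\lambda\vdash n$ means it has $n$ squares. A standard Young tableau (SYT) on an $n$-shape is a filling with $1,\ldots,n$, each once, increasing along rows and down columns. The sign $\mathrm{sgn}(T)$ of a tableau is the sign of the word obtained by reading its entries row by row, left to right, top to bottom; the sign of a word of distinct integers is $(-1)^{\#\text{inversions}}$. $I_\lambda=\sum_{T\in\mathrm{SYT}(\lambda)}\mathrm{sgn}(T)$. $v(\lambda)$ is the maximal number of disjoint vertical dominoes ($2\times1$ rectangles) that fit in $\lambda$. A fourling is a $2\times2$ square; a fourling shape is a (possibly empty) shape that is a union of fourlings, i.e. a shape $\mu$ with $\mu_{2i-1}=\mu_{2i}$ even for all $i$; the fourling body $\mathrm{fb}(\lambda)$ is the largest fourling shape contained in $\lambda$.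
   Formalization: The single case n = 0 with D empty is excluded, because there the only shape is the empty one, with v = 0 and I = 1, so the sum equals 1 rather than 0. *)

theory Defs
  imports Main
begin

text \<open>
  A shape is given by its list of row lengths (weakly decreasing, positive), so that the empty
  shape is the empty list.  Rows and columns are numbered from \<open>0\<close>.
\<close>

definition shape :: "nat list \<Rightarrow> bool" where
  "shape l \<longleftrightarrow> sorted_wrt (\<ge>) l \<and> 0 \<notin> set l"

definition shape_of :: "nat list \<Rightarrow> nat \<Rightarrow> bool"  (infix "\<turnstile>" 50) where
  "l \<turnstile> n \<longleftrightarrow> shape l \<and> sum_list l = n"

definition row_len :: "nat list \<Rightarrow> nat \<Rightarrow> nat" where
  "row_len l i = (if i < length l then l ! i else 0)"

definition diagram :: "nat list \<Rightarrow> (nat \<times> nat) set" where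
  "diagram l = {(i, j). i < length l \<and> j < l ! i}"

text \<open>A tableau is the list of its rows, so its reading word is the concatenation of the rows.\<close>

definition SYT :: "nat list \<Rightarrow> nat list list set" where
  "SYT l = {T. map length T = l
     \<and> distinct (concat T) \<and> set (concat T) = {1..sum_list l}
     \<and> (\<forall>row \<in> set T. sorted_wrt (<) row)
     \<and> (\<forall>i j. Suc i < length T \<longrightarrow> j < length (T ! Suc i) \<longrightarrow> T ! i ! j < T ! Suc i ! j)}"

definition inversions :: "nat list \<Rightarrow> (nat \<times> nat) set" where
  "inversions w = {(i, j). i < j \<and> j < length w \<and> w ! i > w ! j}"

definition word_sign :: "nat list \<Rightarrow> int" where
  "word_sign w = (-1) ^ card (inversions w)"

definition tableau_sign :: "nat list list \<Rightarrow> int" where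
  "tableau_sign T = word_sign (concat T)"

definition sign_imbalance :: "nat list \<Rightarrow> int" where
  "sign_imbalance l = (\<Sum>T\<in>SYT l. tableau_sign T)"

definition vertical_domino :: "(nat \<times> nat) set \<Rightarrow> bool" where
  "vertical_domino d \<longleftrightarrow> (\<exists>i j. d = {(i, j), (Suc i, j)})"

definition vertical_packings :: "nat list \<Rightarrow> (nat \<times> nat) set set set" where
  "vertical_packings l = {P. (\<forall>d\<in>P. vertical_domino d \<and> d \<subseteq> diagram l) \<and> pairwise disjnt P}"

definition max_vertical :: "nat list \<Rightarrow> nat" where
  "max_vertical l = Max (card ` vertical_packings l)"

definition fourling_shape :: "nat list \<Rightarrow> bool" where
  "fourling_shape m \<longleftrightarrow> shape m \<and>
     (\<forall>i. row_len m (2 * i) = row_len m (2 * i + 1) \<and> even (row_len m (2 * i)))"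

definition is_fourling_body :: "nat list \<Rightarrow> nat list \<Rightarrow> bool" where
  "is_fourling_body l D \<longleftrightarrow> fourling_shape D \<and> diagram D \<subseteq> diagram l \<and>
     (\<forall>m. fourling_shape m \<longrightarrow> diagram m \<subseteq> diagram l \<longrightarrow> diagram m \<subseteq> diagram D)"

definition fb :: "nat list \<Rightarrow> nat list" where
  "fb l = (THE D. is_fourling_body l D)"


text \<open>Well-definedness: the sums and the maximum range over finite sets, and \<open>fb\<close> exists.\<close>

lemma diagram_row_len: "diagram l = {(i, j). j < row_len l i}"
  by (auto simp: diagram_def row_len_def split: if_splits)

lemma diagram_subset_iff: "diagram m \<subseteq> diagram l \<longleftrightarrow> (\<forall>i. row_len m i \<le> row_len l i)"
proof
  assume s: "diagram m \<subseteq> diagram l"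
  show "\<forall>i. row_len m i \<le> row_len l i"
  proof (intro allI, rule ccontr)
    fix i assume "\<not> row_len m i \<le> row_len l i"
    then have "(i, row_len l i) \<in> diagram m" "(i, row_len l i) \<notin> diagram l"
      by (auto simp: diagram_row_len)
    with s show False by blast
  qed
next
  assume "\<forall>i. row_len m i \<le> row_len l i"
  then show "diagram m \<subseteq> diagram l"
    by (force simp: diagram_row_len intro: less_le_trans)
qed

lemma finite_diagram: "finite (diagram l)"
proof -
  have "diagram l = (SIGMA i:{..<length l}. {..<l ! i})"
    by (auto simp: diagram_def)
  then show ?thesis by simp
qed

lemma length_le_sum_list: "0 \<notin> set l \<Longrightarrow> length l \<le> sum_list (l :: nat list)"
  by (induction l) auto

lemma finite_shapes: "finite {l. l \<turnstile> n}"
proof (rule finite_subset)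
  show "{l. l \<turnstile> n} \<subseteq> {l. set l \<subseteq> {..n} \<and> length l \<le> n}"
    by (auto simp: shape_of_def shape_def member_le_sum_list length_le_sum_list)
qed (simp add: finite_lists_length_le)

lemma finite_SYT: "finite (SYT l)"
proof (rule finite_subset)
  let ?R = "{r. set r \<subseteq> {1..sum_list l} \<and> length r \<le> sum_list l}"
  show "SYT l \<subseteq> {T. set T \<subseteq> ?R \<and> length T = length l}"
  proof safe
    fix T assume T: "T \<in> SYT l"
    then show "length T = length l" by (auto simp: SYT_def)
    fix r assume r: "r \<in> set T"
    then have "length r \<in> set l" using T by (auto simp: SYT_def)
    then show "length r \<le> sum_list l" by (simp add: member_le_sum_list)
    fix x assume "x \<in> set r"
    with r have "x \<in> set (concat T)" by auto
    then show "x \<in> {1..sum_list l}" using T unfolding SYT_def by blast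
  qed
  have "finite ?R" by (rule finite_lists_length_le) simp
  then show "finite {T. set T \<subseteq> ?R \<and> length T = length l}"
    by (rule finite_lists_length_eq)
qed

lemma finite_inversions: "finite (inversions w)"
  by (rule finite_subset[of _ "{..<length w} \<times> {..<length w}"]) (auto simp: inversions_def)

lemma finite_vertical_packings: "finite (vertical_packings l)"
  by (rule finite_subset[of _ "Pow (Pow (diagram l))"])
    (auto simp: vertical_packings_def finite_diagram)

lemma vertical_packings_nonempty: "vertical_packings l \<noteq> {}"
  by (rule ex_in_conv[THEN iffD1], rule exI[of _ "{}"]) (simp add: vertical_packings_def)

lemma row_len_antimono:
  assumes "shape l" "i \<le> j"
  shows "row_len l j \<le> row_len l i"
  using assms unfolding shape_def row_len_def sorted_wrt_iff_nth_less
  by (cases "i = j") auto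

lemma length_eq_card_rows:
  assumes "shape l"
  shows "{i. row_len l i > 0} = {..<length l}"
  using assms by (auto simp: row_len_def shape_def in_set_conv_nth split: if_splits)

lemma shape_eqI:
  assumes "shape l" "shape m" "\<And>i. row_len l i = row_len m i"
  shows "l = m"
proof (rule nth_equalityI)
  have "{..<length l} = {..<length m}"
    using assms by (simp flip: length_eq_card_rows)
  then show len: "length l = length m" by simp
  fix i assume "i < length l"
  then show "l ! i = m ! i" using assms(3)[of i] len by (simp add: row_len_def)
qed

lemma shape_exists:
  fixes f :: "nat \<Rightarrow> nat"
  assumes anti: "\<And>i j. i \<le> j \<Longrightarrow> f j \<le> f i" and zero: "f n = 0"
  shows "\<exists>l. shape l \<and> row_len l = f"
proof -
  define k where "k = (LEAST i. f i = 0)"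
  have fk: "f k = 0" unfolding k_def using zero by (rule LeastI)
  have pos: "f i > 0" if "i < k" for i using not_less_Least that unfolding k_def by blast
  define l where "l = map f [0..<k]"
  have "shape l"
    using anti by (auto simp: shape_def l_def sorted_wrt_iff_nth_less) (metis pos less_irrefl)
  moreover have "row_len l i = f i" for i
    using anti[of k i] fk by (auto simp: row_len_def l_def)
  ultimately show ?thesis by blast
qed

lemma is_fourling_body_fb:
  assumes "shape l"
  shows "is_fourling_body l (fb l)"
proof -
  define f where "f i = 2 * (row_len l (2 * (i div 2) + 1) div 2)" for i
  have "f j \<le> f i" if "i \<le> j" for i j
  proof -
    have "2 * (i div 2) + 1 \<le> 2 * (j div 2) + 1" using that by (simp add: div_le_mono)
    then have "row_len l (2 * (j div 2) + 1) \<le> row_len l (2 * (i div 2) + 1)"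
      by (rule row_len_antimono[OF assms])
    then show ?thesis unfolding f_def by (simp add: div_le_mono)
  qed
  moreover have "f (2 * length l) = 0" by (simp add: f_def row_len_def)
  ultimately obtain D where D: "shape D" "row_len D = f" using shape_exists by blast
  have "is_fourling_body l D"
    unfolding is_fourling_body_def diagram_subset_iff
  proof (intro conjI allI impI)
    show "fourling_shape D" using D by (simp add: fourling_shape_def f_def)
    fix i
    have "f i \<le> row_len l (2 * (i div 2) + 1)" unfolding f_def by simp
    also have "\<dots> \<le> row_len l i" by (rule row_len_antimono[OF assms]) linarith
    finally show "row_len D i \<le> row_len l i" by (simp add: D)
  next
    fix m i assume m: "fourling_shape m" and le: "\<forall>i. row_len m i \<le> row_len l i"
    have eq: "row_len m (2 * (i div 2)) = row_len m (2 * (i div 2) + 1)"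
      and ev: "even (row_len m (2 * (i div 2)))" using m unfolding fourling_shape_def by blast+
    have "i = 2 * (i div 2) \<or> i = 2 * (i div 2) + 1" by linarith
    then have i: "row_len m i = row_len m (2 * (i div 2) + 1)" using eq by metis
    then have "row_len m i = 2 * (row_len m i div 2)" using ev eq by simp
    also have "\<dots> \<le> f i" unfolding f_def using le i by (simp add: div_le_mono)
    finally show "row_len m i \<le> row_len D i" by (simp add: D)
  qed
  moreover have "E = D" if "is_fourling_body l E" for E
  proof (rule shape_eqI)
    show "shape E" using that by (simp add: is_fourling_body_def fourling_shape_def)
    show "shape D" by (rule D)
    show "row_len E i = row_len D i" for i
      using that \<open>is_fourling_body l D\<close>
      by (meson is_fourling_body_def diagram_subset_iff le_antisym)
  qed
  ultimately show ?thesis unfolding fb_def by (rule theI)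
qed

end

theory Submission
  imports Defs
begin

text \<open>
  Removing the largest entry gives \<open>I\<^sub>\<lambda> = \<Sum> \<plusminus> I\<^sub>\<mu>\<close>, the sum being over all \<open>\<mu>\<close> obtained by deleting
  a corner \<open>b\<close> of \<open>\<lambda>\<close>, with sign \<open>(-1)\<close> to the number of squares in the rows below \<open>b\<close>. Colour the
  square \<open>(i, j)\<close> by the parity of \<open>j - i\<close>. With these signs, adding or removing boxes at two
  non-adjacent places anticommutes. Hence the tableaux in which two consecutive entries have the same colour cancel, and for
  \<open>n > 0\<close> even only the corners of odd colour contribute to \<open>I\<^sub>\<lambda>\<close>.

  Let \<open>u\<close> be the signed up operator and let \<open>d\<close> be the adjoint of its odd part with respect to the form
  \<open>\<langle>\<lambda>, \<lambda>\<rangle> = (-1)\<^bsup>v(\<lambda>)\<^esup>\<close>. Then \<open>d u + u d\<close> is diagonal with entries \<open>\<Sum> (-1)\<^bsup>row b\<^esup>\<close>, the sum being over the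
  addable and removable boxes \<open>b\<close> of odd colour, and this sum telescopes to \<open>0\<close>. So \<open>d\<close> anticommutes
  with \<open>u\<close> and kills \<open>u\<^sup>n \<emptyset> = \<Sum> I\<^sub>\<lambda> \<lambda>\<close>. Finally a box of odd colour never completes a fourling,
  so \<open>d\<close> commutes with the projection \<open>P\<close> onto the shapes with fourling body \<open>D\<close>, and
  \<open>\<langle>u\<^sup>n \<emptyset>, P u\<^sup>n \<emptyset>\<rangle> = \<langle>u\<^bsup>n-1\<^esup> \<emptyset>, P d u\<^sup>n \<emptyset>\<rangle> = 0\<close>.

  Shapes are handled as functions \<open>f\<close> of row lengths vanishing from \<open>N\<close> on; trailing zero rows do not
  change \<open>sign_imbalance\<close>, so all shapes can share the same number \<open>N\<close> of rows.
\<close>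

section \<open>Row-length functions, boxes and signs\<close>

definition partition_fun :: "nat \<Rightarrow> (nat \<Rightarrow> nat) \<Rightarrow> bool" where
  "partition_fun N f \<longleftrightarrow> antimono f \<and> (\<forall>i\<ge>N. f i = 0)"

definition imbal :: "nat \<Rightarrow> (nat \<Rightarrow> nat) \<Rightarrow> int" where
  "imbal N f = sign_imbalance (map f [0..<N])"

definition removable :: "(nat \<Rightarrow> nat) \<Rightarrow> nat set" where
  "removable f = {r. f (Suc r) < f r}"

text \<open>As with \<open>removable\<close>, a box is named by its row alone: adding creates the
  square \<open>(r, f r)\<close>, removing deletes \<open>(r, f r - 1)\<close>. Row 0 is listed
  separately because \<open>r - 1\<close> would again be 0 there.\<close>

definition addable :: "(nat \<Rightarrow> nat) \<Rightarrow> nat set" where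
  "addable f = {r. r = 0 \<or> f r < f (r - 1)}"

abbreviation add_box :: "(nat \<Rightarrow> nat) \<Rightarrow> nat \<Rightarrow> nat \<Rightarrow> nat" where
  "add_box f r \<equiv> f(r := Suc (f r))"

abbreviation remove_box :: "(nat \<Rightarrow> nat) \<Rightarrow> nat \<Rightarrow> nat \<Rightarrow> nat" where
  "remove_box f r \<equiv> f(r := f r - Suc 0)"

text \<open>Only rows strictly below \<open>r\<close> enter, so the sign is the same with or without
  the box at the end of row \<open>r\<close>.\<close>

definition box_sign :: "nat \<Rightarrow> (nat \<Rightarrow> nat) \<Rightarrow> nat \<Rightarrow> int" where
  "box_sign N f r = (-1) ^ (\<Sum>i\<in>{r<..<N}. f i)"

section \<open>Inserting a maximal letter into a word\<close>

lemma card_inversions_Cons: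
  "card (inversions (x # w)) = length (filter (\<lambda>y. y < x) w) + card (inversions w)"
proof -
  have eq: "inversions (x # w) = (\<lambda>j. (0, Suc j)) ` {j. j < length w \<and> w ! j < x}
      \<union> map_prod Suc Suc ` inversions w" (is "_ = ?A \<union> ?B")
  proof (rule set_eqI)
    fix p :: "nat \<times> nat"
    obtain i j where p: "p = (i, j)" by (cases p)
    show "p \<in> inversions (x # w) \<longleftrightarrow> p \<in> ?A \<union> ?B"
      unfolding p by (cases i; cases j) (auto simp: inversions_def)
  qed
  have "card (inversions (x # w)) = card ?A + card ?B"
    unfolding eq by (rule card_Un_disjoint) (auto simp: finite_inversions)
  moreover have "card ?A = length (filter (\<lambda>y. y < x) w)"
    by (subst card_image) (auto simp: inj_on_def length_filter_conv_card)
  moreover have "card ?B = card (inversions w)"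
    by (rule card_image) (auto simp: inj_on_def)
  ultimately show ?thesis by simp
qed

text \<open>The letter \<open>m\<close> is inverted with every letter after it and with none before
  it.\<close>

lemma card_inversions_insert_max:
  assumes "\<forall>x\<in>set (u @ w). x < m"
  shows "card (inversions (u @ m # w)) = length w + card (inversions (u @ w))"
  using assms
proof (induction u)
  case Nil
  then have "filter (\<lambda>y. y < m) w = w" by (auto simp: filter_id_conv)
  then show ?case by (simp add: card_inversions_Cons)
qed (auto simp: card_inversions_Cons)

lemma word_sign_insert_max:
  "\<forall>x\<in>set (u @ w). x < m \<Longrightarrow> word_sign (u @ m # w) = (-1) ^ length w * word_sign (u @ w)"
  by (simp add: word_sign_def card_inversions_insert_max power_add)

section \<open>Deleting the largest entry of a tableau\<close>

lemma SYT_map_iff: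
  "T \<in> SYT (map f [0..<N]) \<longleftrightarrow> length T = N \<and> (\<forall>i<N. length (T ! i) = f i)
     \<and> distinct (concat T) \<and> set (concat T) = {1..sum f {..<N}}
     \<and> (\<forall>i<N. sorted_wrt (<) (T ! i))
     \<and> (\<forall>i j. Suc i < N \<longrightarrow> j < f (Suc i) \<longrightarrow> T ! i ! j < T ! Suc i ! j)"
proof -
  have len: "map length T = map f [0..<N] \<longleftrightarrow> length T = N \<and> (\<forall>i<N. length (T ! i) = f i)"
    by (subst list_eq_iff_nth_eq) auto
  have sum: "sum_list (map f [0..<N]) = sum f {..<N}"
    by (simp add: interv_sum_list_conv_sum_set_nat atLeast0LessThan)
  show ?thesis
    unfolding SYT_def mem_Collect_eq len sum
    by (simp only: all_set_conv_all_nth[of T]) auto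
qed

lemma concat_list_update:
  "r < length T \<Longrightarrow> concat (T[r := x]) = concat (take r T) @ x @ concat (drop (Suc r) T)"
  by (simp add: upd_conv_take_nth_drop)

lemma concat_split_nth:
  "r < length T \<Longrightarrow> concat T = concat (take r T) @ T ! r @ concat (drop (Suc r) T)"
  using concat_list_update[of r T "T ! r"] by simp

lemma set_nth_subset_concat: "i < length T \<Longrightarrow> set (T ! i) \<subseteq> set (concat T)"
  using nth_mem by fastforce

lemma sum_remove_box:
  assumes "r < N" "f r > 0"
  shows "sum f {..<N} = Suc (sum (remove_box f r) {..<N})"
proof -
  have "sum f {..<N} = f r + sum f ({..<N} - {r})"
    using assms by (simp add: sum.remove)
  moreover have "sum (remove_box f r) {..<N} = (f r - 1) + sum (remove_box f r) ({..<N} - {r})"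
    using assms by (simp add: sum.remove)
  moreover have "sum (remove_box f r) ({..<N} - {r}) = sum f ({..<N} - {r})"
    by (rule sum.cong) auto
  ultimately show ?thesis using assms by simp
qed

text \<open>The new entry exceeds all others and ends its row. Nothing stands below it because
  \<open>f (Suc r) < f r\<close>, so the only new column comparison is with the entry above
  it.\<close>

lemma SYT_append_max:
  assumes f: "antimono f" and r: "r < N" "f (Suc r) < f r"
    and T: "T \<in> SYT (map (remove_box f r) [0..<N])"
  shows "T[r := T ! r @ [sum f {..<N}]] \<in> SYT (map f [0..<N])"
proof -
  let ?g = "remove_box f r" and ?n = "sum f {..<N}"
  let ?T = "T[r := T ! r @ [?n]]"
  have n: "?n = Suc (sum ?g {..<N})" using r by (intro sum_remove_box) auto
  have T': "length T = N" "\<And>i. i < N \<Longrightarrow> length (T ! i) = ?g i"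
     "distinct (concat T)" "set (concat T) = {1..sum ?g {..<N}}"
     "\<And>i. i < N \<Longrightarrow> sorted_wrt (<) (T ! i)"
     "\<And>i j. Suc i < N \<Longrightarrow> j < ?g (Suc i) \<Longrightarrow> T ! i ! j < T ! Suc i ! j"
    using T unfolding SYT_map_iff by auto
  have small: "x < ?n" if "i < N" "x \<in> set (T ! i)" for i x
  proof -
    have "x \<in> {1..sum ?g {..<N}}" using that T'(1,4) set_nth_subset_concat by blast
    then show ?thesis unfolding n by (simp only: atLeastAtMost_iff less_Suc_eq_le)
  qed
  have cT: "concat T = concat (take r T) @ T ! r @ concat (drop (Suc r) T)"
    using T'(1) r by (intro concat_split_nth) simp
  have cT2: "concat ?T = concat (take r T) @ (T ! r @ [?n]) @ concat (drop (Suc r) T)"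
    using T'(1) r by (intro concat_list_update) simp
  have notin: "?n \<notin> set (concat T)" unfolding T'(4) n by (simp only: atLeastAtMost_iff) simp
  show ?thesis unfolding SYT_map_iff
  proof (intro conjI allI impI)
    show "length ?T = N" using T' by simp
    show "length (?T ! i) = f i" if "i < N" for i
      using that T'(1) T'(2)[OF that] r by (cases "i = r") auto
    show "distinct (concat ?T)" using T'(3) notin unfolding cT cT2 by auto
    have "set (concat ?T) = insert ?n (set (concat T))" unfolding cT cT2 by auto
    then show "set (concat ?T) = {1..?n}"
      unfolding T'(4) n by (simp only: atLeastAtMostSuc_conv)
    show "sorted_wrt (<) (?T ! i)" if "i < N" for i
      using that T'(1) T'(5)[OF that] small[OF that]
      by (cases "i = r") (auto simp: sorted_wrt_append)
    show "?T ! i ! j < ?T ! Suc i ! j" if i: "Suc i < N" and j: "j < f (Suc i)" for i j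
    proof -
      \<comment> \<open>The new entry is the lower of the two compared; an old entry of row
        \<open>r\<close> is the lower one; row \<open>r\<close> is the upper row; row
        \<open>r\<close> is not involved.\<close>
      consider "Suc i = r" "j = f r - 1" | "Suc i = r" "j < f r - 1" | "i = r" | "Suc i \<noteq> r" "i \<noteq> r"
        using j by fastforce
      then show ?thesis
      proof cases
        case 1
        have "j < f i" using 1 antimonoD[OF f, of i r] r by simp
        then have "j < length (T ! i)" using T'(2)[of i] i 1 by simp
        then have "T ! i ! j < ?n" using small[of i] i by simp
        then show ?thesis using 1 T'(1) T'(2)[of r] r i by (simp add: nth_append)
      next
        case 2
        then show ?thesis using T'(6)[OF i, of j] T'(1) T'(2)[of r] r by (simp add: nth_append)
      next
        case 3
        then have "j < f r - 1" using r j by simp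
        then show ?thesis using 3 T'(6)[OF i, of j] T'(1) T'(2)[of r] r j by (simp add: nth_append)
      next
        case 4
        then show ?thesis using T'(6)[OF i, of j] j T'(1) by simp
      qed
    qed
  qed
qed

text \<open>A right neighbour of the largest entry, or an entry below it, would have to be larger.
  Hence it sits at the end of a row, at a corner of the shape.\<close>

lemma SYT_remove_max:
  assumes T: "T \<in> SYT (map f [0..<N])" and pos: "sum f {..<N} > 0" and z: "\<forall>i\<ge>N. f i = 0"
  obtains r T' where "r < N" "f (Suc r) < f r" "T' \<in> SYT (map (remove_box f r) [0..<N])"
    "T = T'[r := T' ! r @ [sum f {..<N}]]"
proof -
  let ?n = "sum f {..<N}"
  have T': "length T = N" "\<And>i. i < N \<Longrightarrow> length (T ! i) = f i"
     "distinct (concat T)" "set (concat T) = {1..sum f {..<N}}"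
     "\<And>i. i < N \<Longrightarrow> sorted_wrt (<) (T ! i)"
     "\<And>i j. Suc i < N \<Longrightarrow> j < f (Suc i) \<Longrightarrow> T ! i ! j < T ! Suc i ! j"
    using T unfolding SYT_map_iff by auto
  have le: "x \<le> ?n" if "i < N" "x \<in> set (T ! i)" for i x
  proof -
    have "x \<in> {1..?n}" using that T'(1,4) set_nth_subset_concat by blast
    then show ?thesis by simp
  qed
  have "?n \<in> set (concat T)" using T'(4) pos by auto
  then obtain r where r: "r < N" and nr: "?n \<in> set (T ! r)"
    using T'(1) by (auto simp: in_set_conv_nth[of _ T])
  obtain k where k: "k < length (T ! r)" "T ! r ! k = ?n" using nr by (auto simp: in_set_conv_nth)
  have klast: "Suc k = length (T ! r)"
  proof (rule ccontr)
    assume "Suc k \<noteq> length (T ! r)"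
    then have "Suc k < length (T ! r)" using k by simp
    then have "T ! r ! k < T ! r ! Suc k" "T ! r ! Suc k \<le> ?n"
      using T'(5)[OF r] le[OF r] by (auto simp: sorted_wrt_iff_nth_less)
    then show False using k by simp
  qed
  let ?R = "butlast (T ! r)"
  have last: "T ! r = ?R @ [?n]"
  proof -
    have ne: "T ! r \<noteq> []" using k by auto
    have "k = length (T ! r) - 1" using klast by simp
    then have "last (T ! r) = ?n" using k ne by (simp add: last_conv_nth)
    then show ?thesis using append_butlast_last_id[OF ne] by simp
  qed
  have fr: "f r = Suc k" using klast T'(2)[OF r] by simp
  have rem: "f (Suc r) < f r"
  proof (rule ccontr)
    assume "\<not> f (Suc r) < f r"
    then have k2: "k < f (Suc r)" using fr by simp
    then have r2: "Suc r < N" using z by (metis less_zeroE not_less)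
    have "T ! r ! k < T ! Suc r ! k" using T'(6)[OF r2 k2] .
    moreover have "T ! Suc r ! k \<le> ?n" using le[OF r2] T'(2)[OF r2] k2 by simp
    ultimately show False using k by simp
  qed
  let ?T = "T[r := ?R]" and ?g = "remove_box f r"
  have n: "?n = Suc (sum ?g {..<N})" using r fr by (intro sum_remove_box) auto
  have cT: "concat T = concat (take r T) @ (?R @ [?n]) @ concat (drop (Suc r) T)"
    using T'(1) r concat_split_nth[of r T] last by simp
  have cT2: "concat ?T = concat (take r T) @ ?R @ concat (drop (Suc r) T)"
    using T'(1) r by (intro concat_list_update) simp
  have dist: "distinct (concat ?T)" "?n \<notin> set (concat ?T)" "set (concat T) = insert ?n (set (concat ?T))"
    using T'(3) unfolding cT cT2 by auto
  have "?T \<in> SYT (map ?g [0..<N])" unfolding SYT_map_iff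
  proof (intro conjI allI impI)
    show "length ?T = N" using T' by simp
    show "length (?T ! i) = ?g i" if "i < N" for i
      using that T'(1) T'(2)[OF that] r by (cases "i = r") auto
    show "distinct (concat ?T)" by (rule dist)
    have "set (concat ?T) = {1..?n} - {?n}" using dist T'(4) by blast
    also have "\<dots> = {1..sum ?g {..<N}}" using n by auto
    finally show "set (concat ?T) = {1..sum ?g {..<N}}" .
    show "sorted_wrt (<) (?T ! i)" if "i < N" for i
    proof (cases "i = r")
      case True
      have "sorted_wrt (<) (?R @ [?n])" using T'(5)[OF r] last by metis
      then show ?thesis using True T'(1) r by (simp add: sorted_wrt_append)
    qed (use T'(5)[OF that] in simp)
    show "?T ! i ! j < ?T ! Suc i ! j" if i: "Suc i < N" and j: "j < ?g (Suc i)" for i j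
    proof -
      have "j < f (Suc i)" using j by (auto split: if_splits)
      then have lt: "T ! i ! j < T ! Suc i ! j" using T'(6)[OF i] by simp
      have "?T ! i ! j = T ! i ! j"
      proof (cases "i = r")
        case True
        then have "j < length ?R" using rem j T'(2)[OF r] by simp
        then show ?thesis using True T'(1) r by (simp add: nth_butlast)
      qed simp
      moreover have "?T ! Suc i ! j = T ! Suc i ! j"
      proof (cases "Suc i = r")
        case True
        then have "j < length ?R" using j T'(2)[OF r] by simp
        then show ?thesis using True T'(1) r by (simp add: nth_butlast)
      qed simp
      ultimately show ?thesis using lt by simp
    qed
  qed
  moreover have "T = ?T[r := ?T ! r @ [?n]]"
    using r T'(1) last by (simp add: list_update_same_conv)
  ultimately show ?thesis using that r rem by blast
qed

lemma removable_less: "\<forall>i\<ge>N. f i = 0 \<Longrightarrow> r \<in> removable f \<Longrightarrow> r < N"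
  unfolding removable_def by (rule ccontr) simp

lemma finite_removable: "partition_fun N f \<Longrightarrow> finite (removable f)"
  by (rule finite_subset[of _ "{..<N}"]) (auto simp: partition_fun_def dest: removable_less)

text \<open>The tableaux are classified by the row \<open>r\<close> of their largest entry. Each
  class is the injective image under \<open>F r\<close> of the tableaux on the smaller shape. The
  letters read after the largest entry are exactly those in lower rows, which gives the factor
  \<open>box_sign N f r\<close>.\<close>

lemma imbal_remove_box:
  assumes f: "partition_fun N f" and pos: "sum f {..<N} > 0"
  shows "imbal N f = (\<Sum>r\<in>removable f. box_sign N f r * imbal N (remove_box f r))"
proof -
  let ?n = "sum f {..<N}"
  have anti: "antimono f" and z: "\<forall>i\<ge>N. f i = 0" using f by (auto simp: partition_fun_def)
  define S where "S r = SYT (map (remove_box f r) [0..<N])" for r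
  define F where "F r T = T[r := T ! r @ [?n]]" for r T
  have notin: "?n \<notin> set (T ! i)" if "r \<in> removable f" "T \<in> S r" "i < N" for r T i
  proof -
    have r: "r < N" "f r > 0" using removable_less[OF z that(1)] that(1) by (auto simp: removable_def)
    have "set (concat T) = {1..sum (remove_box f r) {..<N}}" "length T = N"
      using that(2) unfolding S_def SYT_map_iff by auto
    moreover have "set (T ! i) \<subseteq> set (concat T)" using that(3) calculation(2)
      by (intro set_nth_subset_concat) simp
    moreover have "?n \<notin> {1..sum (remove_box f r) {..<N}}"
      unfolding sum_remove_box[of r N f, OF r] by (simp only: atLeastAtMost_iff) simp
    ultimately show ?thesis by blast
  qed
  have len: "length T = N" if "T \<in> S r" for T r
    using that unfolding S_def SYT_map_iff by auto
  have mem: "?n \<in> set (F r T ! i) \<longleftrightarrow> i = r" if "r \<in> removable f" "T \<in> S r" "i < N" for r T i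
    using notin[OF that] len[OF that(2)] removable_less[OF z that(1)] that(3)
    unfolding F_def by (cases "i = r") auto
  have eq: "SYT (map f [0..<N]) = (\<Union>r\<in>removable f. F r ` S r)"
  proof (intro equalityI subsetI)
    fix T assume "T \<in> SYT (map f [0..<N])"
    from SYT_remove_max[OF this pos z] show "T \<in> (\<Union>r\<in>removable f. F r ` S r)"
      unfolding F_def S_def removable_def by blast
  next
    fix T assume "T \<in> (\<Union>r\<in>removable f. F r ` S r)"
    then show "T \<in> SYT (map f [0..<N])"
      using SYT_append_max[OF anti] removable_less[OF z] unfolding F_def S_def
      by (auto simp: removable_def)
  qed
  have inj: "inj_on (F r) (S r)" if r: "r \<in> removable f" for r
  proof (rule inj_onI)
    fix T T' assume a: "T \<in> S r" "T' \<in> S r" "F r T = F r T'"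
    have rN: "r < N" using removable_less[OF z r] .
    show "T = T'"
    proof (rule nth_equalityI)
      show "length T = length T'" using len a by simp
      fix i assume "i < length T"
      then show "T ! i = T' ! i" using a(3) len[OF a(1)] len[OF a(2)] rN
        unfolding F_def by (cases "i = r") (metis nth_list_update_eq butlast_snoc, metis nth_list_update_neq)
    qed
  qed
  have sign: "tableau_sign (F r T) = box_sign N f r * tableau_sign T"
    if r: "r \<in> removable f" and T: "T \<in> S r" for r T
  proof -
    have rN: "r < N" using removable_less[OF z r] .
    let ?u = "concat (take r T) @ T ! r" and ?w = "concat (drop (Suc r) T)"
    have cT: "concat T = ?u @ ?w" using rN len[OF T] by (simp add: concat_split_nth)
    have cF: "concat (F r T) = ?u @ ?n # ?w"
      using rN len[OF T] by (simp add: F_def concat_list_update)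
    have "set (concat T) = {1..sum (remove_box f r) {..<N}}"
      using T unfolding S_def SYT_map_iff by auto
    then have "\<forall>x\<in>set (?u @ ?w). x < ?n"
      using sum_remove_box[of r N f] rN r unfolding cT by (auto simp: removable_def)
    then have "word_sign (?u @ ?n # ?w) = (-1) ^ length ?w * word_sign (?u @ ?w)"
      by (rule word_sign_insert_max)
    moreover have "length ?w = (\<Sum>i\<in>{r<..<N}. f i)"
    proof -
      have "map length (drop (Suc r) T) = drop (Suc r) (map length T)" by (simp add: drop_map)
      also have "map length T = map (remove_box f r) [0..<N]" using T unfolding S_def SYT_def by auto
      also have "drop (Suc r) \<dots> = map (remove_box f r) [Suc r..<N]" by (simp add: drop_map)
      also have "\<dots> = map f [Suc r..<N]" by (rule map_cong) auto
      finally have "length ?w = sum_list (map f [Suc r..<N])" by (simp add: length_concat)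
      also have "\<dots> = sum f {Suc r..<N}" by (simp add: interv_sum_list_conv_sum_set_nat)
      finally show ?thesis by (simp add: atLeastSucLessThan_greaterThanLessThan)
    qed
    ultimately show ?thesis unfolding tableau_sign_def cF cT box_sign_def by simp
  qed
  have "imbal N f = (\<Sum>r\<in>removable f. \<Sum>T\<in>F r ` S r. tableau_sign T)"
    unfolding imbal_def sign_imbalance_def eq
  proof (rule sum.UNION_disjoint)
    show "finite (removable f)" using finite_removable[OF f] .
    show "\<forall>r\<in>removable f. finite (F r ` S r)" by (auto simp: S_def finite_SYT)
    show "\<forall>r\<in>removable f. \<forall>s\<in>removable f. r \<noteq> s \<longrightarrow> F r ` S r \<inter> F s ` S s = {}"
    proof (intro ballI impI)
      fix r s assume rs: "r \<in> removable f" "s \<in> removable f" "r \<noteq> s"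
      show "F r ` S r \<inter> F s ` S s = {}"
      proof (rule ccontr)
        assume "F r ` S r \<inter> F s ` S s \<noteq> {}"
        then obtain T T' where "T \<in> S r" "T' \<in> S s" "F r T = F s T'" by auto
        then show False using mem[of r T r] mem[of s T' r] rs removable_less[OF z] by auto
      qed
    qed
  qed
  also have "\<dots> = (\<Sum>r\<in>removable f. box_sign N f r * imbal N (remove_box f r))"
  proof (rule sum.cong)
    fix r assume r: "r \<in> removable f"
    have "(\<Sum>T\<in>F r ` S r. tableau_sign T) = (\<Sum>T\<in>S r. tableau_sign (F r T))"
      by (simp add: sum.reindex[OF inj[OF r]])
    also have "\<dots> = (\<Sum>T\<in>S r. box_sign N f r * tableau_sign T)"
      using sign[OF r] by (intro sum.cong) auto
    finally show "(\<Sum>T\<in>F r ` S r. tableau_sign T) = box_sign N f r * imbal N (remove_box f r)"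
      by (simp add: sum_distrib_left imbal_def sign_imbalance_def S_def)
  qed simp
  finally show ?thesis .
qed

section \<open>Exchanging the addition and removal of boxes\<close>

lemma box_sign_add_box:
  "box_sign N (add_box f s) r = (if r < s \<and> s < N then - box_sign N f r else box_sign N f r)"
proof (cases "r < s \<and> s < N")
  case True
  have "sum (add_box f s) {r<..<N} = Suc (f s) + sum (add_box f s) ({r<..<N} - {s})"
    using True by (simp add: sum.remove)
  moreover have "sum (add_box f s) ({r<..<N} - {s}) = sum f ({r<..<N} - {s})"
    by (rule sum.cong) auto
  moreover have "sum f {r<..<N} = f s + sum f ({r<..<N} - {s})"
    using True by (simp add: sum.remove)
  ultimately show ?thesis using True by (simp add: box_sign_def)
next
  case False
  have "sum (add_box f s) {r<..<N} = sum f {r<..<N}" using False by (intro sum.cong) auto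
  then show ?thesis using False by (auto simp: box_sign_def)
qed

lemma add_box_remove_box: "f s > 0 \<Longrightarrow> add_box (remove_box f s) s = f"
  by auto

lemma box_sign_remove_box:
  assumes "f s > 0"
  shows "box_sign N (remove_box f s) r = (if r < s \<and> s < N then - box_sign N f r else box_sign N f r)"
  using box_sign_add_box[of N "remove_box f s" s r] unfolding add_box_remove_box[of f s, OF assms] by auto

lemma box_sign_square: "box_sign N f r * box_sign N f r = 1"
  by (simp add: box_sign_def flip: power_add)

lemma partition_fun_remove_box:
  assumes "partition_fun N f" "r \<in> removable f"
  shows "partition_fun N (remove_box f r)"
proof -
  have "f (Suc i) \<le> f i" for i using assms unfolding partition_fun_def antimono_iff_le_Suc by blast
  then have "remove_box f r (Suc i) \<le> remove_box f r i" for i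
    using assms(2) unfolding removable_def by (auto simp: less_Suc_eq_le intro: le_trans[OF diff_le_self])
  then show ?thesis using assms(1) unfolding partition_fun_def antimono_iff_le_Suc by auto
qed

lemma addable_le: "partition_fun M f \<Longrightarrow> r \<in> addable f \<Longrightarrow> r \<le> M"
  unfolding addable_def partition_fun_def by (rule ccontr) auto

lemma partition_fun_mono: "partition_fun M f \<Longrightarrow> M \<le> N \<Longrightarrow> partition_fun N f"
  by (auto simp: partition_fun_def)

text \<open>The bound grows because the box may start the new row \<open>M\<close>.\<close>

lemma partition_fun_add_box:
  assumes "partition_fun M f" "r \<in> addable f"
  shows "partition_fun (Suc M) (add_box f r)"
proof -
  have mono: "f (Suc i) \<le> f i" for i using assms unfolding partition_fun_def antimono_iff_le_Suc by blast
  have "add_box f r (Suc i) \<le> add_box f r i" for i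
    using mono[of i] assms(2) unfolding addable_def by auto
  then show ?thesis using assms(1) addable_le[OF assms] unfolding partition_fun_def antimono_iff_le_Suc by auto
qed

lemma finite_addable: "partition_fun M f \<Longrightarrow> finite (addable f)"
  using addable_le by (auto intro: finite_subset[of _ "{..M}"])

text \<open>The two conditions interact only for \<open>Suc s = r\<close>, and there both sides say
  that row \<open>s\<close> is longer than row \<open>r\<close> by at least two.\<close>

lemma add_remove_exchange:
  assumes "r \<noteq> s"
  shows "r \<in> addable f \<and> s \<in> removable (add_box f r)
    \<longleftrightarrow> s \<in> removable f \<and> r \<in> addable (remove_box f s)"
  using assms by (cases "Suc s = r") (auto simp: addable_def removable_def)

text \<open>This is the anticommutation. A change in one row flips the sign attached to another row
  only if the changed row is the lower one. So the second factor flips on the left if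
  \<open>s < r\<close> and on the right if \<open>r < s\<close>: on exactly one side.\<close>

lemma box_sign_exchange:
  assumes "r \<noteq> s" "r < N" "s < N" "f s > 0"
  shows "box_sign N f r * box_sign N (add_box f r) s
    = - (box_sign N f s * box_sign N (remove_box f s) r)"
  using assms by (auto simp: box_sign_add_box box_sign_remove_box)

section \<open>Odd-content boxes and the vanishing of the signed sum\<close>

text \<open>
  In row \<open>r\<close> the addable box has content \<open>f r - r\<close> and the removable box has
  content \<open>f r - 1 - r\<close>, so both sums range over the corners of odd content.
\<close>

lemma corner_sign_sum:
  assumes f: "partition_fun M f"
  shows "(\<Sum>r | r \<in> addable f \<and> odd (f r + r). (-1) ^ r)
     + (\<Sum>r | r \<in> removable f \<and> even (f r + r). (-1) ^ r) = (0 :: int)"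
proof -
  have z: "f i = 0" if "i \<ge> M" for i using f that by (simp add: partition_fun_def)
  have le: "f (Suc i) \<le> f i" for i using f unfolding partition_fun_def antimono_iff_le_Suc by blast
  \<comment> \<open>Parity indicator for telescoping: the addable box of row \<open>Suc r\<close>
    and the removable box of row \<open>r\<close> together contribute
    \<open>e r - e (Suc r)\<close>. The remaining terms \<open>1 - e 0\<close> and
    \<open>e 0 - e M\<close> cancel because \<open>e M = 1\<close>.\<close>
  define e where "e r = (if even (f r) then 1 else 0 :: int)" for r
  define a where "a r = (if r \<in> addable f \<and> odd (f r + r) then (-1) ^ r else 0 :: int)" for r
  define b where "b r = (if r \<in> removable f \<and> even (f r + r) then (-1) ^ r else 0 :: int)" for r
  have "(\<Sum>r | r \<in> addable f \<and> odd (f r + r). (-1) ^ r) = sum a {..<Suc M}"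
    unfolding a_def using addable_le[OF f]
    by (subst sum.inter_filter[symmetric]) (auto intro!: sum.cong simp: less_Suc_eq_le)
  moreover have "(\<Sum>r | r \<in> removable f \<and> even (f r + r). (-1) ^ r) = sum b {..<M}"
    unfolding b_def using removable_less[of M f] z
    by (subst sum.inter_filter[symmetric]) (auto intro!: sum.cong)
  moreover have "sum a {..<Suc M} = a 0 + (\<Sum>r<M. a (Suc r))"
    by (rule sum.lessThan_Suc_shift)
  moreover have "a 0 = 1 - e 0" by (simp add: a_def e_def addable_def)
  moreover have "a (Suc r) + b r = e r - e (Suc r)" for r
    using le[of r] by (auto simp: a_def b_def e_def addable_def removable_def)
  then have "(\<Sum>r<M. a (Suc r)) + sum b {..<M} = (\<Sum>r<M. e r - e (Suc r))"
    by (simp flip: sum.distrib)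
  moreover have "(\<Sum>r<M. e r - e (Suc r)) = e 0 - e M" by (rule sum_lessThan_telescope')
  moreover have "e M = 1" by (simp add: e_def z)
  ultimately show ?thesis by simp
qed

text \<open>
  Expanding \<open>imbal N (add_box f r)\<close> by removing a box, the terms where a different box is removed
  are, by anticommutation, the same sums for smaller shapes; the diagonal terms give \<open>imbal N f\<close>
  times the sum in \<open>corner_sign_sum\<close>.
\<close>

lemma odd_content_up_zero:
  assumes "partition_fun M f" "M < N"
  shows "(\<Sum>r | r \<in> addable f \<and> odd (f r + r). (-1) ^ r * box_sign N f r * imbal N (add_box f r)) = 0"
  using assms
proof (induction "sum f {..<N}" arbitrary: f rule: less_induct)
  case IH: (less f)
  note f = IH.prems(1)
  have fN: "partition_fun N f" using partition_fun_mono[OF f] IH.prems by simp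
  have pos: "f s > 0" if "s \<in> removable f" for s using that by (auto simp: removable_def)
  have sN: "s < N" if "s \<in> removable f" for s
    using that fN removable_less unfolding partition_fun_def by blast
  define A where "A g = {r. r \<in> addable g \<and> odd (g r + r)}" for g :: "nat \<Rightarrow> nat"
  \<comment> \<open>\<open>t r s\<close> adds in row \<open>r\<close> and then removes in row
    \<open>s\<close>; \<open>t' s r\<close> does the same in the opposite order. The weight
    \<open>(-1) ^ r\<close> always belongs to the added box.\<close>
  define t where "t r s = (-1) ^ r * box_sign N f r * box_sign N (add_box f r) s
      * imbal N (remove_box (add_box f r) s)" for r s
  define t' where "t' s r = box_sign N f s * ((-1) ^ r * box_sign N (remove_box f s) r
      * imbal N (add_box (remove_box f s) r))" for s r
  have finA: "finite (A g)" if "partition_fun M g" for g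
    using finite_addable[OF that] by (simp add: A_def)
  have rN: "r < N" if "r \<in> addable f" for r using addable_le[OF f that] IH.prems by simp
  have add: "partition_fun N (add_box f r)" if "r \<in> addable f" for r
    using partition_fun_add_box[OF f that] partition_fun_mono IH.prems by simp
  have "(\<Sum>r\<in>A f. (-1) ^ r * box_sign N f r * imbal N (add_box f r))
      = (\<Sum>r\<in>A f. \<Sum>s\<in>removable (add_box f r). t r s)"
  proof (rule sum.cong)
    fix r assume "r \<in> A f"
    then have r: "r \<in> addable f" by (simp add: A_def)
    have "0 < add_box f r r" by simp
    also have "\<dots> \<le> sum (add_box f r) {..<N}" using rN[OF r] by (intro member_le_sum) auto
    finally show "(-1) ^ r * box_sign N f r * imbal N (add_box f r)
      = (\<Sum>s\<in>removable (add_box f r). t r s)"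
      by (subst imbal_remove_box[OF add[OF r]]) (auto simp: t_def sum_distrib_left mult.assoc)
  qed simp
  also have "\<dots> = (\<Sum>r\<in>A f. t r r + (\<Sum>s\<in>removable (add_box f r) - {r}. t r s))"
  proof (rule sum.cong)
    fix r assume "r \<in> A f"
    then have r: "r \<in> addable f" by (simp add: A_def)
    have "f (Suc r) \<le> f r" using f by (auto simp: partition_fun_def antimono_iff_le_Suc)
    then have "r \<in> removable (add_box f r)" by (simp add: removable_def)
    then show "(\<Sum>s\<in>removable (add_box f r). t r s) = t r r + (\<Sum>s\<in>removable (add_box f r) - {r}. t r s)"
      using finite_removable[OF add[OF r]] by (simp add: sum.remove)
  qed simp
  also have "\<dots> = (\<Sum>r\<in>A f. t r r) + (\<Sum>r\<in>A f. \<Sum>s\<in>removable (add_box f r) - {r}. t r s)"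
    by (rule sum.distrib)
  also have "(\<Sum>r\<in>A f. t r r) = (\<Sum>r\<in>A f. (-1) ^ r) * imbal N f"
    unfolding sum_distrib_right
  proof (rule sum.cong)
    fix r
    have "box_sign N f r * box_sign N (add_box f r) r = 1"
      using box_sign_square by (simp add: box_sign_add_box)
    then show "t r r = (-1) ^ r * imbal N f" by (simp add: t_def)
  qed simp
  also have "(\<Sum>r\<in>A f. \<Sum>s\<in>removable (add_box f r) - {r}. t r s)
      = (\<Sum>(r, s)\<in>(SIGMA r:A f. removable (add_box f r) - {r}). t r s)"
    using finA[OF f] finite_removable[OF add] by (intro sum.Sigma) (auto simp: A_def)
  also have "\<dots> = (\<Sum>(s, r)\<in>(SIGMA s:removable f. A (remove_box f s) - {s}). - t' s r)"
  proof (rule sum.reindex_bij_witness[where i = prod.swap and j = prod.swap])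
    fix p assume p: "p \<in> (SIGMA r:A f. removable (add_box f r) - {r})"
    then obtain r s where rs: "p = (r, s)" "r \<in> addable f" "odd (f r + r)" "s \<in> removable (add_box f r)" "s \<noteq> r"
      by (auto simp: A_def)
    then have *: "s \<in> removable f" "r \<in> addable (remove_box f s)"
      using add_remove_exchange[of r s f] by auto
    then show "prod.swap p \<in> (SIGMA s:removable f. A (remove_box f s) - {s})"
      using rs by (simp add: A_def)
    have "remove_box (add_box f r) s = add_box (remove_box f s) r"
      using rs(5) by auto
    moreover have "box_sign N f r * box_sign N (add_box f r) s
      = - (box_sign N f s * box_sign N (remove_box f s) r)"
      using rs rN sN[OF *(1)] pos[OF *(1)] by (intro box_sign_exchange) auto
    ultimately have "t r s = - t' s r"
      unfolding t_def t'_def by (simp only: mult.assoc) (simp add: algebra_simps)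
    then show "(case prod.swap p of (s, r) \<Rightarrow> - t' s r) = (case p of (r, s) \<Rightarrow> t r s)"
      by (simp add: rs(1))
  next
    fix p assume p: "p \<in> (SIGMA s:removable f. A (remove_box f s) - {s})"
    then obtain r s where rs: "p = (s, r)" "s \<in> removable f" "r \<in> addable (remove_box f s)" "odd (f r + r)" "s \<noteq> r"
      by (auto simp: A_def split: if_splits)
    then show "prod.swap p \<in> (SIGMA r:A f. removable (add_box f r) - {r})"
      using add_remove_exchange[of r s f] by (simp add: A_def)
  qed auto
  also have "\<dots> = (\<Sum>s\<in>removable f. \<Sum>r\<in>A (remove_box f s) - {s}. - t' s r)"
    using finA[OF partition_fun_remove_box[OF f]] finite_removable[OF f]
    by (intro sum.Sigma[symmetric]) auto
  \<comment> \<open>For the smaller shape \<open>remove_box f s\<close> the induction hypothesis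
    says that the full sum over \<open>r\<close> vanishes. The sum over \<open>r\<close> different
    from \<open>s\<close> is therefore minus the term at \<open>r = s\<close>, which puts the box
    back and is present only if the box has odd content.\<close>
  also have "\<dots> = (\<Sum>s\<in>removable f. if even (f s + s) then (-1) ^ s * imbal N f else 0)"
  proof (rule sum.cong)
    fix s assume s: "s \<in> removable f"
    let ?g = "remove_box f s"
    have g: "partition_fun M ?g" using partition_fun_remove_box[OF f s] .
    have fin: "finite (A ?g)" using finA[OF g] .
    have "sum ?g {..<N} < sum f {..<N}" using sum_remove_box[of s N f] sN[OF s] pos[OF s] by simp
    from IH.hyps[OF this g IH.prems(2)]
    have zero: "(\<Sum>r\<in>A ?g. t' s r) = 0" unfolding t'_def A_def by (simp flip: sum_distrib_left)
    have f_eq: "add_box ?g s = f" using add_box_remove_box[of f s] pos[OF s] by simp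
    have tss: "t' s s = (-1) ^ s * imbal N f"
      using box_sign_square[of N f s] unfolding t'_def f_eq
      by (simp add: box_sign_remove_box pos[OF s])
    have "s \<in> addable ?g"
    proof (cases s)
      case (Suc k)
      have "f s \<le> f k" using f Suc by (auto simp: partition_fun_def antimono_iff_le_Suc)
      then show ?thesis using pos[OF s] Suc by (auto simp: addable_def)
    qed (simp add: addable_def)
    then have sA: "s \<in> A ?g \<longleftrightarrow> even (f s + s)"
      using pos[OF s] by (auto simp: A_def)
    show "(\<Sum>r\<in>A ?g - {s}. - t' s r) = (if even (f s + s) then (-1) ^ s * imbal N f else 0)"
    proof (cases "even (f s + s)")
      case True
      then show ?thesis using zero fin tss sA
        by (simp add: sum_negf sum_diff1)
    next
      case False
      then show ?thesis using zero sA by (simp add: sum_negf)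
    qed
  qed simp
  also have "\<dots> = (\<Sum>s | s \<in> removable f \<and> even (f s + s). (-1) ^ s) * imbal N f"
    using finite_removable[OF f] unfolding sum_distrib_right
    by (simp add: sum.inter_filter)
  also have "(\<Sum>r\<in>A f. (-1) ^ r) * imbal N f
      + (\<Sum>s | s \<in> removable f \<and> even (f s + s). (-1) ^ s) * imbal N f = 0"
    unfolding A_def distrib_right[symmetric] corner_sign_sum[OF f] by simp
  finally show ?case unfolding A_def .
qed

section \<open>Cancellation by the colour of the largest entry's box\<close>

text \<open>
  Here the box removed, which carries the entry \<open>n\<close>, has a content of the same parity as \<open>n\<close>.
  By induction the box carrying \<open>n - 1\<close> may be taken of that same parity; then the two boxes are not
  adjacent and the swapped tableau has the opposite sign.
\<close>

lemma wrong_colour_zero: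
  assumes "partition_fun N f"
  shows "(\<Sum>r | r \<in> removable f \<and> odd (f r + r + sum f {..<N}).
    box_sign N f r * imbal N (remove_box f r)) = 0"
  using assms
proof (induction "sum f {..<N}" arbitrary: f rule: less_induct)
  case IH: (less f)
  let ?n = "sum f {..<N}"
  note f = IH.prems(1)
  have pos: "f s > 0" if "s \<in> removable f" for s using that by (auto simp: removable_def)
  have sN: "s < N" if "s \<in> removable f" for s
    using that f removable_less unfolding partition_fun_def by blast
  define W where "W = {r. r \<in> removable f \<and> odd (f r + r + ?n)}"
  define V where "V r = {s. s \<in> W \<and> s \<noteq> r}" for r
  define t where "t r s = box_sign N f r * box_sign N (remove_box f r) s
      * imbal N (remove_box (remove_box f r) s)" for r s
  have fin: "finite W" using finite_removable[OF f] by (simp add: W_def)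
  have "(\<Sum>r\<in>W. box_sign N f r * imbal N (remove_box f r)) = (\<Sum>r\<in>W. \<Sum>s\<in>V r. t r s)"
  proof (rule sum.cong)
    fix r assume "r \<in> W"
    then have r: "r \<in> removable f" "odd (f r + r + ?n)" by (auto simp: W_def)
    let ?g = "remove_box f r"
    let ?m = "sum ?g {..<N}"
    have g: "partition_fun N ?g" using partition_fun_remove_box[OF f r(1)] .
    have n: "?n = Suc ?m" using sN[OF r(1)] pos[OF r(1)] by (rule sum_remove_box)
    \<comment> \<open>If only one square were left to remove, it would be \<open>(0, 0)\<close>,
      whose content 0 is even while the entry 1 is odd; so \<open>r\<close> would not lie in
      \<open>W\<close>.\<close>
    have "?m > 0"
    proof (rule ccontr)
      assume m: "\<not> ?m > 0"
      then have g0: "?g i = 0" if "i < N" for i using that by simp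
      then have fr: "f r = 1" using sN[OF r(1)] pos[OF r(1)] by (metis Suc_pred' One_nat_def fun_upd_same)
      have "r = 0"
      proof (rule ccontr)
        assume "r \<noteq> 0"
        then have "f 0 = 0" using g0[of 0] sN[OF r(1)] by simp
        moreover have "f r \<le> f 0" using f by (auto simp: partition_fun_def dest: antimonoD)
        ultimately show False using pos[OF r(1)] by simp
      qed
      moreover have "?n = 1" using n m by linarith
      ultimately show False using r(2) fr by simp
    qed
    then have "imbal N ?g = (\<Sum>s\<in>removable ?g. box_sign N ?g s * imbal N (remove_box ?g s))"
      by (rule imbal_remove_box[OF g])
    also have "\<dots> = (\<Sum>s | s \<in> removable ?g \<and> odd (?g s + s + ?m). box_sign N ?g s * imbal N (remove_box ?g s))
      + (\<Sum>s | s \<in> removable ?g \<and> even (?g s + s + ?m). box_sign N ?g s * imbal N (remove_box ?g s))"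
      using finite_removable[OF g] by (subst sum.union_disjoint[symmetric]) (auto intro!: sum.cong)
    also have "(\<Sum>s | s \<in> removable ?g \<and> odd (?g s + s + ?m). box_sign N ?g s * imbal N (remove_box ?g s)) = 0"
      using IH.hyps[OF _ g] n by simp
    \<comment> \<open>Row \<open>r\<close> itself drops out by parity. For other rows, removability
      in \<open>?g\<close> and in \<open>f\<close> can differ only if \<open>Suc s = r\<close> and
      \<open>f s = f r\<close>; then the two boxes are vertically adjacent and have contents of
      different parity.\<close>
    also have "{s. s \<in> removable ?g \<and> even (?g s + s + ?m)} = V r"
    proof (rule set_eqI)
      fix s
      have le: "f (Suc s) \<le> f s" using f by (auto simp: partition_fun_def antimono_iff_le_Suc)
      have "s \<in> removable ?g \<and> even (?g s + s + ?m) \<longleftrightarrow> s \<noteq> r \<and> s \<in> removable ?g \<and> odd (f s + s + ?n)"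
      proof (cases "s = r")
        case True
        then show ?thesis using r(2) n pos[OF r(1)] by simp
      qed (auto simp: n)
      also have "\<dots> \<longleftrightarrow> s \<noteq> r \<and> s \<in> removable f \<and> odd (f s + s + ?n)"
      proof (cases "Suc s = r")
        case True
        then have "f r < f s" if "odd (f s + s + ?n)"
          using le that r(2) by (cases "f r = f s") auto
        then show ?thesis using True by (auto simp: removable_def)
      qed (auto simp: removable_def)
      finally show "s \<in> {s. s \<in> removable ?g \<and> even (?g s + s + ?m)} \<longleftrightarrow> s \<in> V r"
        by (auto simp: V_def W_def)
    qed
    finally show "box_sign N f r * imbal N ?g = (\<Sum>s\<in>V r. t r s)"
      unfolding t_def by (simp only: sum_distrib_left mult.assoc add_0_left)
  qed simp
  also have "\<dots> = (\<Sum>(r, s)\<in>Sigma W V. t r s)"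
    using fin by (intro sum.Sigma) (auto simp: V_def)
  finally have eq: "(\<Sum>r\<in>W. box_sign N f r * imbal N (remove_box f r)) = (\<Sum>(r, s)\<in>Sigma W V. t r s)" .
  have "(\<Sum>(r, s)\<in>Sigma W V. t r s) = (\<Sum>(r, s)\<in>Sigma W V. - t r s)"
  proof (rule sum.reindex_bij_witness[where i = prod.swap and j = prod.swap])
    fix p assume "p \<in> Sigma W V"
    then obtain r s where rs: "p = (r, s)" "r \<in> W" "s \<in> W" "r \<noteq> s" by (auto simp: V_def)
    then have "r \<in> removable f" "s \<in> removable f" by (auto simp: W_def)
    then have "box_sign N f s * box_sign N (remove_box f s) r = - (box_sign N f r * box_sign N (remove_box f r) s)"
      using rs(4) pos sN by (auto simp: box_sign_remove_box)
    moreover have "remove_box (remove_box f r) s = remove_box (remove_box f s) r"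
      using rs(4) by auto
    ultimately have "t s r = - t r s" unfolding t_def by simp
    then show "(case prod.swap p of (r, s) \<Rightarrow> - t r s) = (case p of (r, s) \<Rightarrow> t r s)"
      by (simp add: rs(1))
  qed (auto simp: V_def)
  then have "(\<Sum>(r, s)\<in>Sigma W V. t r s) = 0" by (simp add: sum_negf case_prod_unfold)
  then show ?case using eq unfolding W_def by simp
qed

text \<open>The removed box has content \<open>f r - 1 - r\<close>, which is odd exactly if
  \<open>f r + r\<close> is even. For an even number of squares the other rows form the sum in
  \<open>wrong_colour_zero\<close>.\<close>

lemma imbal_remove_odd_content:
  assumes f: "partition_fun N f" and "sum f {..<N} > 0" "even (sum f {..<N})"
  shows "imbal N f = (\<Sum>r | r \<in> removable f \<and> even (f r + r). box_sign N f r * imbal N (remove_box f r))"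
proof -
  let ?t = "\<lambda>r. box_sign N f r * imbal N (remove_box f r)"
  have "imbal N f = (\<Sum>r\<in>removable f. ?t r)" using assms by (intro imbal_remove_box)
  also have "\<dots> = (\<Sum>r | r \<in> removable f \<and> odd (f r + r + sum f {..<N}). ?t r)
      + (\<Sum>r | r \<in> removable f \<and> even (f r + r). ?t r)"
    using finite_removable[OF f] assms(3)
    by (subst sum.union_disjoint[symmetric]) (auto intro!: sum.cong)
  finally show ?thesis using wrong_colour_zero[OF f] by simp
qed

section \<open>From shapes to row-length functions\<close>

lemma sign_imbalance_append_zeros: "sign_imbalance (l @ replicate k 0) = sign_imbalance l"
proof -
  let ?z = "replicate k ([] :: nat list)"
  \<comment> \<open>Rows of length 0 are forced to be empty lists, so they add no letter to the
    reading word, and appending them matches the two sets of tableaux.\<close>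
  have len: "map length T = l @ replicate k 0 \<longleftrightarrow> (\<exists>T'. T = T' @ ?z \<and> map length T' = l)"
    for T :: "nat list list"
  proof
    assume "map length T = l @ replicate k 0"
    then obtain us vs where uv: "T = us @ vs" "map length us = l" "map length vs = replicate k 0"
      by (auto simp: map_eq_append_conv)
    have "vs = ?z"
    proof (rule replicate_eqI)
      show "length vs = k" using arg_cong[OF uv(3), of length] by simp
      show "y = []" if "y \<in> set vs" for y
      proof -
        have "length y \<in> set (map length vs)" using that by simp
        then show ?thesis unfolding uv(3) by auto
      qed
    qed
    then show "\<exists>T'. T = T' @ ?z \<and> map length T' = l" using uv by blast
  qed auto
  have eq: "T @ ?z \<in> SYT (l @ replicate k 0) \<longleftrightarrow> T \<in> SYT l" for T
    by (auto simp: SYT_def nth_append sum_list_replicate)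
  have "SYT (l @ replicate k 0) = (\<lambda>T. T @ ?z) ` SYT l"
  proof (intro equalityI subsetI)
    fix T assume T: "T \<in> SYT (l @ replicate k 0)"
    then obtain T' where "T = T' @ ?z" using len[of T] by (auto simp: SYT_def)
    then show "T \<in> (\<lambda>T. T @ ?z) ` SYT l" using T eq by blast
  qed (use eq in blast)
  moreover have "inj_on (\<lambda>T. T @ ?z) (SYT l)" by (auto simp: inj_on_def)
  ultimately show ?thesis
    unfolding sign_imbalance_def by (simp add: sum.reindex tableau_sign_def)
qed

lemma map_row_len: "length l \<le> N \<Longrightarrow> map (row_len l) [0..<N] = l @ replicate (N - length l) 0"
  by (rule nth_equalityI) (auto simp: row_len_def nth_append)

lemma imbal_row_len: "length l \<le> N \<Longrightarrow> imbal N (row_len l) = sign_imbalance l"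
  by (simp add: imbal_def map_row_len sign_imbalance_append_zeros)

lemma sum_row_len: "length l \<le> N \<Longrightarrow> sum (row_len l) {..<N} = sum_list l"
  using arg_cong[OF map_row_len[of l N], of sum_list]
  by (simp add: interv_sum_list_conv_sum_set_nat atLeast0LessThan sum_list_replicate)

lemma partition_fun_row_len: "shape l \<Longrightarrow> length l \<le> N \<Longrightarrow> partition_fun N (row_len l)"
  using row_len_antimono by (auto simp: partition_fun_def antimono_def) (simp add: row_len_def)

text \<open>Every nonzero row holds a square, so there are at most \<open>n\<close> of them. If
  \<open>n < N\<close>, this leaves an empty row in which a box can still be added.\<close>

lemma partition_fun_small:
  assumes f: "partition_fun N f" and n: "sum f {..<N} = n"
  shows "partition_fun n f"
proof -
  have "f i = 0" if "i \<ge> n" for i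
  proof (rule ccontr)
    assume fi: "f i \<noteq> 0"
    then have "i < N" using f by (meson partition_fun_def not_less)
    have "f j \<ge> 1" if "j \<le> i" for j
      using f that fi by (auto simp: partition_fun_def Suc_le_eq dest!: antimonoD[of f j i])
    then have "(\<Sum>j\<in>{..i}. 1) \<le> sum f {..i}" by (intro sum_mono) auto
    also have "\<dots> \<le> sum f {..<N}" using \<open>i < N\<close> by (intro sum_mono2) auto
    finally show False using n that by simp
  qed
  then show ?thesis using f by (simp add: partition_fun_def)
qed

definition partition_funs :: "nat \<Rightarrow> nat \<Rightarrow> (nat \<Rightarrow> nat) set" where
  "partition_funs N n = {f. partition_fun N f \<and> sum f {..<N} = n}"

lemma bij_betw_row_len:
  assumes "n \<le> N"
  shows "bij_betw row_len {l. l \<turnstile> n} (partition_funs N n)"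
proof (rule bij_betwI')
  fix l m assume "l \<in> {l. l \<turnstile> n}" "m \<in> {l. l \<turnstile> n}"
  then show "row_len l = row_len m \<longleftrightarrow> l = m"
    using shape_eqI by (auto simp: shape_of_def)
next
  fix l assume "l \<in> {l. l \<turnstile> n}"
  then have l: "shape l" "sum_list l = n" by (auto simp: shape_of_def)
  then have "length l \<le> N" using length_le_sum_list[of l] assms by (simp add: shape_def)
  then show "row_len l \<in> partition_funs N n"
    using l by (simp add: partition_funs_def partition_fun_row_len sum_row_len)
next
  fix f assume "f \<in> partition_funs N n"
  then have f: "partition_fun N f" "sum f {..<N} = n" by (auto simp: partition_funs_def)
  have "f j \<le> f i" if "i \<le> j" for i j
    using f(1) that by (auto simp: partition_fun_def dest: antimonoD)
  moreover have "f N = 0" using f(1) by (simp add: partition_fun_def)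
  ultimately obtain l where l: "shape l" "row_len l = f" using shape_exists by blast
  have "length l \<le> N"
  proof (rule ccontr)
    assume "\<not> length l \<le> N"
    then have "N \<in> {i. row_len l i > 0}" unfolding length_eq_card_rows[OF l(1)] by simp
    then show False using l f by (simp add: partition_fun_def)
  qed
  then have "sum_list l = n" using sum_row_len[of l N] l f by simp
  then show "\<exists>l\<in>{l. l \<turnstile> n}. f = row_len l" using l by (auto simp: shape_of_def)
qed

section \<open>Packings by vertical dominoes\<close>

lemma vertical_packing_card_le:
  assumes "P \<in> vertical_packings l"
  shows "card P \<le> card {b \<in> diagram l. odd (fst b)}"
proof (rule card_inj_on_le)
  \<comment> \<open>The square of a vertical domino in an odd row: its two rows are consecutive, so
    there is exactly one, and disjoint dominoes have different ones.\<close>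
  define h where "h d = (THE b. b \<in> d \<and> odd (fst b))" for d :: "(nat \<times> nat) set"
  have h: "h d \<in> d \<and> odd (fst (h d))" if "d \<in> P" for d
  proof -
    have "vertical_domino d" using assms that by (auto simp: vertical_packings_def)
    then obtain i j where d: "d = {(i, j), (Suc i, j)}" by (auto simp: vertical_domino_def)
    have "\<exists>!b. b \<in> d \<and> odd (fst b)" unfolding d by (cases "odd i") auto
    then show ?thesis unfolding h_def by (rule theI')
  qed
  show "inj_on h P"
  proof (rule inj_onI)
    fix d e assume "d \<in> P" "e \<in> P" "h d = h e"
    then have "\<not> disjnt d e" using h[of d] h[of e] by (auto simp: disjnt_def)
    then show "d = e" using assms \<open>d \<in> P\<close> \<open>e \<in> P\<close>
      by (auto simp: vertical_packings_def pairwise_def)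
  qed
  show "h ` P \<subseteq> {b \<in> diagram l. odd (fst b)}"
  proof (rule image_subsetI)
    fix d assume "d \<in> P"
    then have "d \<subseteq> diagram l" using assms by (auto simp: vertical_packings_def)
    then show "h d \<in> {b \<in> diagram l. odd (fst b)}" using h[OF \<open>d \<in> P\<close>] by blast
  qed
qed (simp add: finite_diagram)

text \<open>The bound of \<open>vertical_packing_card_le\<close> is attained by pairing every square
  in an odd row with the square above it. These dominoes are disjoint because their upper squares
  lie in even rows.\<close>

lemma max_vertical_eq_card:
  assumes "shape l"
  shows "max_vertical l = card {b \<in> diagram l. odd (fst b)}"
proof -
  let ?B = "{b \<in> diagram l. odd (fst b)}"
  define d where "d b = {(fst b - 1, snd b), b}" for b :: "nat \<times> nat"
  have dom: "d b = {(i, j), (Suc i, j)}" "even i" "b = (Suc i, j)" if "b \<in> ?B" "i = fst b - 1" "j = snd b" for b i j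
  proof -
    have "fst b = Suc i" using that by (cases "fst b") auto
    then show "b = (Suc i, j)" using that by (cases b) auto
    then show "d b = {(i, j), (Suc i, j)}" "even i" using that by (auto simp: d_def)
  qed
  have disj: "disjnt (d b) (d c)" if "b \<in> ?B" "c \<in> ?B" "b \<noteq> c" for b c
    unfolding dom(1)[OF that(1) refl refl] dom(1)[OF that(2) refl refl]
    using dom(2,3)[OF that(1) refl refl] dom(2,3)[OF that(2) refl refl] that(3)
    by (auto simp: disjnt_def)
  have "inj_on d ?B"
  proof (rule inj_onI, rule ccontr)
    fix b c assume "b \<in> ?B" "c \<in> ?B" "d b = d c" "b \<noteq> c"
    then have "disjnt (d b) (d b)" using disj[of b c] by simp
    then show False by (simp add: disjnt_def d_def)
  qed
  then have card: "card (d ` ?B) = card ?B" by (rule card_image)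
  have "d ` ?B \<in> vertical_packings l"
    unfolding vertical_packings_def
  proof (intro CollectI conjI ballI)
    fix e assume "e \<in> d ` ?B"
    then obtain b where b: "b \<in> ?B" "e = d b" by blast
    let ?i = "fst b - 1" and ?j = "snd b"
    note D = dom[OF b(1) refl refl]
    show "vertical_domino e" unfolding b(2) D(1) vertical_domino_def by blast
    have "(Suc ?i, ?j) \<in> diagram l" using b(1) D(3) by simp
    then have "(?i, ?j) \<in> diagram l"
      using row_len_antimono[OF assms, of ?i "Suc ?i"] by (simp add: diagram_row_len)
    then show "e \<subseteq> diagram l" using \<open>(Suc ?i, ?j) \<in> diagram l\<close> unfolding b(2) D(1) by simp
  next
    show "pairwise disjnt (d ` ?B)" by (rule pairwise_imageI) (rule disj)
  qed
  from imageI[OF this, of card] have "card ?B \<in> card ` vertical_packings l" unfolding card .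
  then show ?thesis unfolding max_vertical_def
    using vertical_packing_card_le finite_vertical_packings
    by (intro Max_eqI) auto
qed

lemma max_vertical_eq_sum:
  assumes "shape l" "length l \<le> N"
  shows "max_vertical l = (\<Sum>i | i < N \<and> odd i. row_len l i)"
proof -
  have "{b \<in> diagram l. odd (fst b)} = (SIGMA i:{i. i < N \<and> odd i}. {..<row_len l i})"
    using assms(2) by (auto simp: diagram_row_len row_len_def split: if_splits)
  then show ?thesis by (simp add: max_vertical_eq_card[OF assms(1)])
qed

section \<open>Fourling bodies\<close>

definition body :: "(nat \<Rightarrow> nat) \<Rightarrow> nat list" where
  "body f = (THE D. fourling_shape D \<and> (\<forall>i. row_len D i \<le> f i) \<and>
     (\<forall>m. fourling_shape m \<longrightarrow> (\<forall>i. row_len m i \<le> f i) \<longrightarrow> diagram m \<subseteq> diagram D))"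

text \<open>The property defining \<open>fb\<close> mentions the shape only through its row lengths;
  \<open>body\<close> can thus be applied to functions such as \<open>add_box f r\<close>
  directly.\<close>

lemma fb_eq_body: "fb l = body (row_len l)"
  by (simp add: fb_def body_def is_fourling_body_def diagram_subset_iff[of _ l])

text \<open>In an even row \<open>r\<close> the new box would be the upper right square of its
  fourling, but the square below it is missing. In an odd row it would be the lower left square, but
  the square to its right is missing. So no fourling shape can use the new box.\<close>

lemma fourling_add_box:
  assumes m: "fourling_shape m" and f: "antimono f" and c: "odd (f r + r)"
  shows "(\<forall>i. row_len m i \<le> add_box f r i) \<longleftrightarrow> (\<forall>i. row_len m i \<le> f i)"
proof
  assume le: "\<forall>i. row_len m i \<le> add_box f r i"
  have ev: "row_len m (2 * k) = row_len m (2 * k + 1)" "even (row_len m (2 * k))" for k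
    using m unfolding fourling_shape_def by blast+
  have "row_len m r \<noteq> Suc (f r)"
  proof
    assume eq: "row_len m r = Suc (f r)"
    show False
    proof (cases "even r")
      case True
      then have "row_len m (Suc r) = Suc (f r)" using ev(1)[of "r div 2"] eq by simp
      then have "Suc (f r) \<le> f (Suc r)" using le[rule_format, of "Suc r"] by simp
      then show False using antimonoD[OF f, of r "Suc r"] by simp
    next
      case False
      then have "even (row_len m r)" using ev[of "r div 2"] by simp
      then show False using eq c False by simp
    qed
  qed
  then show "\<forall>i. row_len m i \<le> f i" using le by (metis fun_upd_apply le_SucE)
next
  assume "\<forall>i. row_len m i \<le> f i"
  then show "\<forall>i. row_len m i \<le> add_box f r i" by (simp add: le_SucI)
qed

lemma body_add_box:
  assumes "antimono f" "odd (f r + r)"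
  shows "body (add_box f r) = body f"
  unfolding body_def by (simp only: fourling_add_box[OF _ assms] cong: conj_cong imp_cong)

section \<open>The sum over a fixed fourling body\<close>

lemma sum_odd_rows_add_box:
  assumes "r < N"
  shows "(-1) ^ (\<Sum>i | i < N \<and> odd i. add_box f r i)
    = (-1) ^ r * ((-1) ^ (\<Sum>i | i < N \<and> odd i. f i) :: int)"
proof -
  have "(\<Sum>i | i < N \<and> odd i. add_box f r i) = (\<Sum>i | i < N \<and> odd i. f i + (if i = r then 1 else 0))"
    by (rule sum.cong) auto
  also have "\<dots> = (\<Sum>i | i < N \<and> odd i. f i) + (if odd r then 1 else 0)"
    using assms by (simp add: sum.distrib)
  finally show ?thesis by auto
qed

text \<open>The case of \<open>n = 0\<close> with empty \<open>D\<close> is excluded because the sum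
  is then 1: the empty shape has one tableau, of sign 1, and no dominoes.\<close>

theorem theorem3p4:
  fixes D :: "nat list" and n :: nat
  assumes "fourling_shape D" and "even n"
    and "n \<noteq> 0 \<or> D \<noteq> []"
  shows "(\<Sum>l | l \<turnstile> n \<and> fb l = D. (-1) ^ max_vertical l * (sign_imbalance l)\<^sup>2) = (0 :: int)"
proof (cases "n = 0")
  case True
  have "fb [] = []"
  proof -
    have fb: "is_fourling_body [] (fb [])" by (rule is_fourling_body_fb) (simp add: shape_def)
    then have "row_len (fb []) i = row_len [] i" for i
      unfolding is_fourling_body_def diagram_subset_iff by (simp add: row_len_def)
    then show ?thesis using fb
      by (intro shape_eqI) (auto simp: is_fourling_body_def fourling_shape_def shape_def)
  qed
  then have "{l. l \<turnstile> n \<and> fb l = D} = {}" using assms(3) True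
    by (auto simp: shape_of_def shape_def) (metis list.set_intros(1) neq_Nil_conv)
  then show ?thesis by (simp only: sum.empty)
next
  case False
  define N where "N = Suc n"
  \<comment> \<open>By \<open>max_vertical_eq_sum\<close> this is the sign given by the maximal
    number of vertical dominoes; adding a box in row \<open>r\<close> multiplies it by
    \<open>(-1) ^ r\<close>.\<close>
  define V :: "(nat \<Rightarrow> nat) \<Rightarrow> int" where "V f = (-1) ^ (\<Sum>i | i < N \<and> odd i. f i)" for f
  define S where "S k = {f \<in> partition_funs N k. body f = D}" for k
  define R where "R f = {r. r \<in> removable f \<and> even (f r + r)}" for f :: "nat \<Rightarrow> nat"
  define A where "A f = {r. r \<in> addable f \<and> odd (f r + r)}" for f :: "nat \<Rightarrow> nat"
  have finS: "finite (S k)" if "k \<le> N" for k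
    using bij_betw_finite[OF bij_betw_row_len[OF that]] finite_shapes by (simp add: S_def)
  have finR: "finite (R f)" if "f \<in> S k" for f k
    using that finite_removable by (auto simp: S_def R_def partition_funs_def)
  have finA: "finite (A f)" if "f \<in> S k" for f k
    using that finite_addable by (auto simp: S_def A_def partition_funs_def)
  have bij: "bij_betw row_len {l. l \<turnstile> n \<and> fb l = D} (S n)"
  proof -
    have b: "bij_betw row_len {l. l \<turnstile> n} (partition_funs N n)"
      by (rule bij_betw_row_len) (simp add: N_def)
    have "row_len ` {l. l \<turnstile> n \<and> fb l = D} = {f \<in> row_len ` {l. l \<turnstile> n}. body f = D}"
      by (auto simp: fb_eq_body)
    also have "\<dots> = S n" unfolding S_def bij_betw_imp_surj_on[OF b] by (rule refl)
    finally show ?thesis by (rule bij_betw_subset[OF b, rotated]) auto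
  qed
  have "(\<Sum>l | l \<turnstile> n \<and> fb l = D. (-1) ^ max_vertical l * (sign_imbalance l)\<^sup>2)
      = (\<Sum>l | l \<turnstile> n \<and> fb l = D. V (row_len l) * (imbal N (row_len l))\<^sup>2)"
  proof (rule sum.cong)
    fix l assume "l \<in> {l. l \<turnstile> n \<and> fb l = D}"
    then have l: "shape l" "sum_list l = n" by (auto simp: shape_of_def)
    then have "length l \<le> N" using length_le_sum_list[of l] by (simp add: shape_def N_def)
    then show "(-1) ^ max_vertical l * (sign_imbalance l)\<^sup>2 = V (row_len l) * (imbal N (row_len l))\<^sup>2"
      using l by (simp add: V_def imbal_row_len max_vertical_eq_sum)
  qed simp
  also have "\<dots> = (\<Sum>f\<in>S n. V f * (imbal N f)\<^sup>2)"
    by (rule sum.reindex_bij_betw[OF bij])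
  \<comment> \<open>One factor of the square is expanded over the removable boxes of odd content;
    the other is kept.\<close>
  also have "\<dots> = (\<Sum>f\<in>S n. \<Sum>r\<in>R f. V f * imbal N f * (box_sign N f r * imbal N (remove_box f r)))"
  proof (rule sum.cong)
    fix f assume "f \<in> S n"
    then have "imbal N f = (\<Sum>r\<in>R f. box_sign N f r * imbal N (remove_box f r))"
      unfolding R_def using False assms(2)
      by (intro imbal_remove_odd_content) (auto simp: S_def partition_funs_def)
    then show "V f * (imbal N f)\<^sup>2
      = (\<Sum>r\<in>R f. V f * imbal N f * (box_sign N f r * imbal N (remove_box f r)))"
      unfolding sum_distrib_left[symmetric] by (simp add: power2_eq_square)
  qed simp
  also have "\<dots> = (\<Sum>(f, r)\<in>Sigma (S n) R. V f * imbal N f * (box_sign N f r * imbal N (remove_box f r)))"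
    using finS[of n] finR by (intro sum.Sigma) (auto simp: N_def)
  \<comment> \<open>Adjointness: a shape with a removed box becomes the smaller shape with an added
    box. Both have body \<open>D\<close>, since the box has odd content, and the change in
    \<open>V\<close> produces the weight \<open>(-1) ^ r\<close>.\<close>
  also have "\<dots> = (\<Sum>(g, r)\<in>Sigma (S (n - 1)) A.
      V g * imbal N g * ((-1) ^ r * box_sign N g r * imbal N (add_box g r)))"
  proof (rule sum.reindex_bij_witness[where i = "\<lambda>(g, r). (add_box g r, r)" and j = "\<lambda>(f, r). (remove_box f r, r)"])
    fix p assume "p \<in> Sigma (S n) R"
    then obtain f r where p: "p = (f, r)" "f \<in> S n" "r \<in> R f" by auto
    let ?g = "remove_box f r"
    have f: "partition_fun N f" "sum f {..<N} = n" "body f = D" and r: "r \<in> removable f" "even (f r + r)"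
      using p by (auto simp: S_def R_def partition_funs_def)
    have pos: "f r > 0" using r by (simp add: removable_def)
    have rN: "r < N" using r f removable_less by (auto simp: partition_fun_def)
    have restore: "add_box ?g r = f" using pos by (rule add_box_remove_box)
    have g: "partition_fun N ?g" using partition_fun_remove_box[OF f(1) r(1)] .
    have odd: "odd (?g r + r)" using r(2) pos by auto
    have add: "r \<in> addable ?g"
    proof (cases r)
      case (Suc k)
      have "f r \<le> f k" using f Suc by (auto simp: partition_fun_def antimono_iff_le_Suc)
      then show ?thesis using pos Suc by (auto simp: addable_def)
    qed (simp add: addable_def)
    have "body ?g = D" using body_add_box[of ?g r] odd g f(3) unfolding restore
      by (simp add: partition_fun_def)
    moreover have "sum ?g {..<N} = n - 1" using sum_remove_box[of r N f] rN pos f by simp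
    ultimately show "(case p of (f, r) \<Rightarrow> (remove_box f r, r)) \<in> Sigma (S (n - 1)) A"
      using g add odd by (simp add: p(1) S_def A_def partition_funs_def)
    show "(case case p of (f, r) \<Rightarrow> (remove_box f r, r) of (g, r) \<Rightarrow> (add_box g r, r)) = p"
      using restore by (simp add: p(1))
    have "V f = (-1) ^ r * V ?g"
      using sum_odd_rows_add_box[OF rN, of ?g] unfolding restore V_def by simp
    moreover have "box_sign N f r = box_sign N ?g r"
      by (simp add: box_sign_remove_box pos)
    ultimately show "(case case p of (f, r) \<Rightarrow> (remove_box f r, r) of
          (g, r) \<Rightarrow> V g * imbal N g * ((-1) ^ r * box_sign N g r * imbal N (add_box g r)))
        = (case p of (f, r) \<Rightarrow> V f * imbal N f * (box_sign N f r * imbal N (remove_box f r)))"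
      unfolding p(1) prod.case restore by (simp add: mult_ac)
  next
    fix p assume "p \<in> Sigma (S (n - 1)) A"
    then obtain g r where p: "p = (g, r)" "g \<in> S (n - 1)" "r \<in> A g" by auto
    let ?f = "add_box g r"
    have g: "partition_fun N g" "sum g {..<N} = n - 1" "body g = D" and r: "r \<in> addable g" "odd (g r + r)"
      using p by (auto simp: S_def A_def partition_funs_def)
    have g': "partition_fun (n - 1) g" using partition_fun_small g by blast
    have rN: "r < N" using addable_le[OF g' r(1)] by (simp add: N_def)
    show "(case case p of (g, r) \<Rightarrow> (add_box g r, r) of (f, r) \<Rightarrow> (remove_box f r, r)) = p"
      by (simp add: p(1))
    have f: "partition_fun N ?f"
      using partition_fun_mono[OF partition_fun_add_box[OF g' r(1)]] by (simp add: N_def)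
    moreover have "body ?f = D" using body_add_box g r(2) by (simp add: partition_fun_def)
    moreover have "sum ?f {..<N} = n" using sum_remove_box[of r N ?f] rN g False by simp
    moreover have "r \<in> removable ?f"
      using g by (auto simp: removable_def partition_fun_def antimono_iff_le_Suc less_Suc_eq_le)
    ultimately show "(case p of (g, r) \<Rightarrow> (add_box g r, r)) \<in> Sigma (S n) R"
      using r by (simp add: p(1) S_def R_def partition_funs_def)
  qed
  also have "\<dots> = (\<Sum>g\<in>S (n - 1). \<Sum>r\<in>A g.
      V g * imbal N g * ((-1) ^ r * box_sign N g r * imbal N (add_box g r)))"
    using finS[of "n - 1"] finA by (intro sum.Sigma[symmetric]) (auto simp: N_def)
  also have "\<dots> = 0"
  proof (rule sum.neutral, rule ballI)
    fix g assume "g \<in> S (n - 1)"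
    then have "partition_fun (n - 1) g"
      using partition_fun_small by (auto simp: S_def partition_funs_def)
    then have "(\<Sum>r\<in>A g. (-1) ^ r * box_sign N g r * imbal N (add_box g r)) = 0"
      unfolding A_def by (rule odd_content_up_zero) (simp add: N_def)
    then show "(\<Sum>r\<in>A g. V g * imbal N g * ((-1) ^ r * box_sign N g r * imbal N (add_box g r))) = 0"
      by (simp flip: sum_distrib_left)
  qed
  finally show ?thesis .
qed

end
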